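(* Let $\sigma$ be an even probability measure on $\mathbb{T}$ with infinite support, with orthonormal polynomials $\{\phi_n\}$ and Verblunsky coefficients $\{\gamma_n\}_{n\ge0}$, and assume that $\|\{\gamma_n\}\|_{\ell^2}\le\frac12$. For an arc $I\subset\mathbb{T}$, let $\nu:=|I|^{-1}$. Then for each $\ell\in\mathbb{N}$, $$\int_I|\phi_m|^2\,d\sigma\ \lesssim\ |I|+O_\ell\Bigl(\sum_{n\ge0}(n+1)^{-\ell}\sum_{|s-m|<\nu(n+1),\ s\ge0}|\gamma_s|^2\Bigr)+O_\ell\bigl((m/\nu)^{-\ell}\bigr),$$ provided that $m\gtrsim\nu$. That is: for every $c>0$ there are a constant $C$ and, for each $\ell\in\mathbb{N}$, a constant $C_\ell$ (all independent of $\sigma$, $I$ and $m$) such that for every such $\sigma$, every arc $I$ with $|I|>0$ and every integer $m\ge c\,\nu$, $$\int_I|\phi_m|^2\,d\sigma\le C|I|+C_\ell\sum_{n\ge0}(n+1)^{-\ell}\sum_{|s-m|<\nu(n+1),\ s\ge0}|\gamma_s|^2+C_\ell\,(m/\nu)^{-\ell}.$$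
   Context: $\mathbb{T}$ is the unit circle; $|I|$ is the arclength (Lebesgue measure) of the arc $I$. "Even" means invariant under $z\mapsto1/z$. $\Phi_n$ is the monic orthogonal polynomial of degree $n$ in $L^2_\sigma(\mathbb{T})$, $\phi_n=\Phi_n/\|\Phi_n\|_{2,\sigma}$, $\Phi_n^*(z)=z^n\overline{\Phi_n(1/\bar z)}$, and the Verblunsky coefficients $\gamma_n$ are determined by $\Phi_{n+1}(z)=z\Phi_n(z)-\overline{\gamma_n}\,\Phi_n^*(z)$, $\Phi_0=1$. The right-hand side may be $+\infty$. *)

theory Defs
  imports "HOL-Probability.Probability" "HOL-Computational_Algebra.Polynomial"
begin

abbreviation unit_circle :: "complex set" where
  "unit_circle \<equiv> sphere 0 1"

definition circle_prob_measure :: "complex measure \<Rightarrow> bool" where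
  "circle_prob_measure \<sigma> \<longleftrightarrow>
     prob_space \<sigma> \<and> sets \<sigma> = sets (restrict_space borel unit_circle)"

definition even_measure :: "complex measure \<Rightarrow> bool" where
  "even_measure \<sigma> \<longleftrightarrow> distr \<sigma> \<sigma> (\<lambda>z. 1 / z) = \<sigma>"

definition circle_support :: "complex measure \<Rightarrow> complex set" where
  "circle_support \<sigma> =
     {z \<in> unit_circle. \<forall>U. open U \<longrightarrow> z \<in> U \<longrightarrow> emeasure \<sigma> (U \<inter> unit_circle) > 0}"

text \<open>The interval \<open>J\<close> may be open, closed or half-open, and may be longer than \<open>2 * pi\<close>,
  in which case the arc is the whole circle.\<close>

definition is_arc :: "complex set \<Rightarrow> bool" where
  "is_arc I \<longleftrightarrow> (\<exists>J::real set. is_interval J \<and> I = cis ` J)"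

definition arclength :: "complex set \<Rightarrow> real" where
  "arclength A = measure lborel {t \<in> {0..<2 * pi}. cis t \<in> A}"

definition inner_L2 :: "complex measure \<Rightarrow> complex poly \<Rightarrow> complex poly \<Rightarrow> complex" where
  "inner_L2 \<sigma> p q = (LINT z|\<sigma>. poly p z * cnj (poly q z))"

definition norm_L2 :: "complex measure \<Rightarrow> complex poly \<Rightarrow> real" where
  "norm_L2 \<sigma> p = sqrt (LINT z|\<sigma>. (cmod (poly p z))\<^sup>2)"

text \<open>The definite descriptions below are meaningful for measures of infinite support on the
  circle: there the monic orthogonal polynomials exist and are unique, and so does the
  coefficient in the Szego recursion.\<close>

definition monic_OP :: "complex measure \<Rightarrow> nat \<Rightarrow> complex poly" where
  "monic_OP \<sigma> n = (THE p. degree p = n \<and> lead_coeff p = 1 \<and>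
     (\<forall>q. degree q < n \<longrightarrow> inner_L2 \<sigma> p q = 0))"

definition orthonormal_OP :: "complex measure \<Rightarrow> nat \<Rightarrow> complex poly" where
  "orthonormal_OP \<sigma> n =
     smult (complex_of_real (1 / norm_L2 \<sigma> (monic_OP \<sigma> n))) (monic_OP \<sigma> n)"

text \<open>This formula for the reversed polynomial is only correct for \<open>z \<noteq> 0\<close> (division by zero
  yields zero); hence the recursion is required on the punctured plane, which determines
  the polynomials.\<close>

definition reversed_OP :: "complex measure \<Rightarrow> nat \<Rightarrow> complex \<Rightarrow> complex" where
  "reversed_OP \<sigma> n z = z ^ n * cnj (poly (monic_OP \<sigma> n) (1 / cnj z))"

definition verblunsky :: "complex measure \<Rightarrow> nat \<Rightarrow> complex" where
  "verblunsky \<sigma> n = (THE g. \<forall>z. z \<noteq> 0 \<longrightarrow>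
     poly (monic_OP \<sigma> (Suc n)) z = z * poly (monic_OP \<sigma> n) z - cnj g * reversed_OP \<sigma> n z)"

text \<open>The bound on the norm includes membership in \<open>\<ell>\<^sup>2\<close>: without the summability
  condition \<open>suminf\<close> would be unspecified.\<close>

definition ell2_norm_le :: "(nat \<Rightarrow> complex) \<Rightarrow> real \<Rightarrow> bool" where
  "ell2_norm_le a r \<longleftrightarrow>
     summable (\<lambda>n. (cmod (a n))\<^sup>2) \<and> sqrt (\<Sum>n. (cmod (a n))\<^sup>2) \<le> r"

text \<open>The series is taken in \<open>ennreal\<close> since it can diverge; the inner sums are finite.\<close>

definition verblunsky_tail :: "complex measure \<Rightarrow> real \<Rightarrow> nat \<Rightarrow> nat \<Rightarrow> ennreal" where
  "verblunsky_tail \<sigma> \<nu> m l =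
     (\<Sum>n. ennreal ((real n + 1) powi (- int l) *
        (\<Sum>s\<in>{s. \<bar>real s - real m\<bar> < \<nu> * (real n + 1)}. (cmod (verblunsky \<sigma> s))\<^sup>2)))"

end

theory Submission imports Defs begin

text \<open>
  Comparing leading coefficients, the inner product of \<open>z^k \<phi>\<^sub>m\<close> with \<open>\<phi>\<^sub>m\<^sub>+\<^sub>k\<close> is the product
  of the factors \<open>sqrt (1 - |\<gamma>\<^sub>s|\<^sup>2)\<close> over \<open>m \<le> s < m + k\<close>, so that the squared distance of these
  two unit vectors is at most \<open>2 (|\<gamma>\<^sub>m|\<^sup>2 + \<dots> + |\<gamma>\<^sub>m\<^sub>+\<^sub>k\<^sub>-\<^sub>1|\<^sup>2)\<close>. Let \<open>N = \<lfloor>\<nu>\<rfloor>\<close>, let \<open>\<zeta>\<close> be a point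
  of the arc, and let \<open>Q\<close> be the average of \<open>(z / \<zeta>)^k\<close> over \<open>k < N\<close>. Then \<open>|Q| \<ge> 1/2\<close> on the arc,
  while \<open>Q \<phi>\<^sub>m\<close> is close to an average of \<open>N\<close> orthonormal functions, whose squared norm is \<open>1/N\<close>.
  Hence already the first term \<open>|I|\<close> and the summand \<open>n = 0\<close> of the tail bound the integral.
\<close>

section \<open>Conjugation and reversal of polynomials on the unit circle\<close>

lemma power_mult_cnj: "cmod z = 1 \<Longrightarrow> z ^ k * cnj (z ^ k) = 1"
  by (metis complex_norm_square norm_power of_real_1 power_one)

lemma poly_map_poly_cnj: "poly (map_poly cnj p) z = cnj (poly p (cnj z))"
  by (induction p) (simp_all add: map_poly_pCons)

text \<open>This is the operation \<open>p\<^sup>*\<close> with respect to the degree of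
  \<open>p\<close>, encoded as a genuine polynomial: away from 0 it gives the values in
  \<open>reversed_OP\<close>, and \<open>inner_L2\<close> and \<open>norm_L2\<close> can be applied
  to it.\<close>

definition cnj_reflect_poly :: "complex poly \<Rightarrow> complex poly" where
  "cnj_reflect_poly p = reflect_poly (map_poly cnj p)"

lemma degree_map_poly_cnj [simp]: "degree (map_poly cnj p) = degree p"
  by (rule degree_map_poly) auto

lemma degree_cnj_reflect_poly_le: "degree (cnj_reflect_poly p) \<le> degree p"
  unfolding cnj_reflect_poly_def by (metis degree_reflect_poly_le degree_map_poly_cnj)

lemma poly_cnj_reflect_poly:
  "z \<noteq> 0 \<Longrightarrow> poly (cnj_reflect_poly p) z = z ^ degree p * cnj (poly p (1 / cnj z))"
  by (simp add: cnj_reflect_poly_def poly_reflect_poly_nz poly_map_poly_cnj inverse_eq_divide)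

lemma poly_cnj_reflect_poly_circle:
  assumes "cmod z = 1"
  shows "poly (cnj_reflect_poly p) z = z ^ degree p * cnj (poly p z)"
proof -
  have "z * cnj z = 1"
    using power_mult_cnj[OF assms, of 1] by simp
  then have "z \<noteq> 0" "1 / cnj z = z"
    by (auto simp: divide_eq_eq)
  then show ?thesis by (simp add: poly_cnj_reflect_poly)
qed

text \<open>The leading terms cancel. Equality of \<open>p\<close> and \<open>q\<close> is excluded
  because the zero polynomial has degree 0, which is not less than \<open>n = 0\<close>.\<close>

lemma degree_diff_monic_less:
  fixes p q :: "'a::comm_ring_1 poly"
  assumes "degree p = n" "lead_coeff p = 1" "degree q = n" "lead_coeff q = 1" "p \<noteq> q"
  shows "degree (p - q) < n"
proof -
  have "coeff (p - q) i = 0" if "i \<ge> n" for i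
    using assms that by (cases "i = n") (auto simp: coeff_eq_0)
  moreover have "lead_coeff (p - q) \<noteq> 0"
    using assms(5) by (simp del: coeff_diff)
  ultimately show ?thesis
    by (meson not_le)
qed

section \<open>The inner product on polynomials given by the measure\<close>

locale circle_measure =
  fixes \<sigma> :: "complex measure"
  assumes circle_prob: "circle_prob_measure \<sigma>"
    and infinite_support: "infinite (circle_support \<sigma>)"
begin

sublocale prob_space \<sigma>
  using circle_prob by (simp add: circle_prob_measure_def)

lemma sets_eq: "sets \<sigma> = sets (restrict_space borel unit_circle)"
  using circle_prob by (simp add: circle_prob_measure_def)

lemma space_eq: "space \<sigma> = unit_circle"
  using sets_eq_imp_space_eq[OF sets_eq] by (simp add: space_restrict_space)

lemma cmod_space: "z \<in> space \<sigma> \<Longrightarrow> cmod z = 1"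
  by (simp add: space_eq)

lemma integrable_continuous:
  fixes f :: "complex \<Rightarrow> 'b::{banach, second_countable_topology}"
  assumes "continuous_on unit_circle f"
  shows "integrable \<sigma> f"
proof -
  have meas: "f \<in> borel_measurable \<sigma>"
    using borel_measurable_continuous_on_restrict[OF assms] measurable_cong_sets[OF sets_eq refl]
    by blast
  have "bounded (f ` unit_circle)"
    using assms by (intro compact_imp_bounded compact_continuous_image) auto
  then obtain B where "\<forall>z\<in>unit_circle. norm (f z) \<le> B"
    unfolding bounded_iff by blast
  then show ?thesis
    using meas by (intro integrable_const_bound[where B = B] AE_I2) (auto simp: space_eq)
qed

lemma integrable_inner: "integrable \<sigma> (\<lambda>z. poly p z * cnj (poly q z))"
  by (intro integrable_continuous continuous_intros)

lemma integrable_cmod_sq: "integrable \<sigma> (\<lambda>z. (cmod (poly p z))\<^sup>2)"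
  by (intro integrable_continuous continuous_intros)

lemma inner_add_left: "inner_L2 \<sigma> (p + r) q = inner_L2 \<sigma> p q + inner_L2 \<sigma> r q"
  by (simp add: inner_L2_def distrib_right integrable_inner)

lemma inner_diff_left: "inner_L2 \<sigma> (p - r) q = inner_L2 \<sigma> p q - inner_L2 \<sigma> r q"
  by (simp add: inner_L2_def left_diff_distrib integrable_inner)

lemma inner_smult_left: "inner_L2 \<sigma> (smult c p) q = c * inner_L2 \<sigma> p q"
  by (simp add: inner_L2_def mult.assoc)

lemma inner_cnj: "cnj (inner_L2 \<sigma> p q) = inner_L2 \<sigma> q p"
  unfolding inner_L2_def
  by (simp add: mult.commute flip: Bochner_Integration.integral_cnj)

lemma inner_add_right: "inner_L2 \<sigma> q (p + r) = inner_L2 \<sigma> q p + inner_L2 \<sigma> q r"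
  by (metis inner_add_left inner_cnj complex_cnj_add)

lemma inner_diff_right: "inner_L2 \<sigma> q (p - r) = inner_L2 \<sigma> q p - inner_L2 \<sigma> q r"
  by (metis inner_diff_left inner_cnj complex_cnj_diff)

lemma inner_smult_right: "inner_L2 \<sigma> q (smult c p) = cnj c * inner_L2 \<sigma> q p"
  by (metis inner_smult_left inner_cnj complex_cnj_mult)

lemma inner_monom_mult: "inner_L2 \<sigma> (monom 1 k * p) (monom 1 k * q) = inner_L2 \<sigma> p q"
  unfolding inner_L2_def
proof (rule Bochner_Integration.integral_cong[OF refl])
  fix z assume "z \<in> space \<sigma>"
  then have "z ^ k * cnj (z ^ k) = 1"
    by (intro power_mult_cnj cmod_space)
  then show "poly (monom 1 k * p) z * cnj (poly (monom 1 k * q) z) = poly p z * cnj (poly q z)"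
    by (simp add: poly_monom)
qed

lemma norm_sq: "(norm_L2 \<sigma> p)\<^sup>2 = (LINT z|\<sigma>. (cmod (poly p z))\<^sup>2)"
  by (simp add: norm_L2_def)

lemma norm_nonneg: "norm_L2 \<sigma> p \<ge> 0"
  by (simp add: norm_L2_def)

lemma inner_self: "inner_L2 \<sigma> p p = complex_of_real ((norm_L2 \<sigma> p)\<^sup>2)"
  unfolding norm_sq inner_L2_def
  by (simp add: complex_norm_square flip: integral_complex_of_real of_real_power)

lemma norm_sq_eq: "(norm_L2 \<sigma> p)\<^sup>2 = Re (inner_L2 \<sigma> p p)"
  by (simp add: inner_self)

lemma norm_smult: "norm_L2 \<sigma> (smult c p) = cmod c * norm_L2 \<sigma> p"
  by (simp add: norm_L2_def norm_mult power_mult_distrib real_sqrt_mult)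

lemma norm_monom_mult: "norm_L2 \<sigma> (monom 1 k * p) = norm_L2 \<sigma> p"
  by (metis inner_monom_mult norm_sq_eq norm_nonneg power2_eq_imp_eq)

lemma norm_add_sq:
  "(norm_L2 \<sigma> (p + q))\<^sup>2 = (norm_L2 \<sigma> p)\<^sup>2 + 2 * Re (inner_L2 \<sigma> p q) + (norm_L2 \<sigma> q)\<^sup>2"
proof -
  have "Re (inner_L2 \<sigma> q p) = Re (inner_L2 \<sigma> p q)"
    by (metis inner_cnj cnj.simps(1))
  then show ?thesis
    unfolding norm_sq_eq by (simp add: inner_add_left inner_add_right)
qed

lemma norm_diff_sq:
  "(norm_L2 \<sigma> (p - q))\<^sup>2 = (norm_L2 \<sigma> p)\<^sup>2 - 2 * Re (inner_L2 \<sigma> p q) + (norm_L2 \<sigma> q)\<^sup>2"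
proof -
  have "Re (inner_L2 \<sigma> q p) = Re (inner_L2 \<sigma> p q)"
    by (metis inner_cnj cnj.simps(1))
  then show ?thesis
    unfolding norm_sq_eq by (simp add: inner_diff_left inner_diff_right)
qed

text \<open>This is where infinite support enters. A polynomial of norm zero vanishes almost
  everywhere, hence on the whole support, since its nonzero set is open; but a nonzero polynomial
  has finitely many roots.\<close>

lemma norm_eq_0_imp:
  assumes "norm_L2 \<sigma> p = 0"
  shows "p = 0"
proof (rule ccontr)
  assume "p \<noteq> 0"
  have "(LINT z|\<sigma>. (cmod (poly p z))\<^sup>2) = 0"
    using norm_sq[of p] assms by simp
  then have ae: "AE z in \<sigma>. poly p z = 0"
    using integral_nonneg_eq_0_iff_AE[OF integrable_cmod_sq[of p]] by simp
  have "circle_support \<sigma> \<subseteq> {z. poly p z = 0}"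
  proof (rule ccontr)
    assume "\<not> ?thesis"
    then obtain z where z: "z \<in> circle_support \<sigma>" "poly p z \<noteq> 0" by auto
    define U where "U = {z. poly p z \<noteq> 0}"
    have op: "open U"
      unfolding U_def by (intro open_Collect_neq continuous_intros)
    then have "emeasure \<sigma> (U \<inter> unit_circle) > 0"
      using z by (auto simp: circle_support_def U_def)
    moreover have "U \<inter> unit_circle \<in> sets \<sigma>"
      using op unfolding sets_eq sets_restrict_space by auto
    moreover have "AE z in \<sigma>. z \<notin> U \<inter> unit_circle"
      using ae by eventually_elim (auto simp: U_def)
    ultimately show False
      using AE_iff_null_sets[of "U \<inter> unit_circle" \<sigma>] by auto
  qed
  then show False
    using infinite_support poly_roots_finite[OF \<open>p \<noteq> 0\<close>] finite_subset by blast
qed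

section \<open>Monic orthogonal polynomials and their uniqueness\<close>

definition is_monic_OP :: "nat \<Rightarrow> complex poly \<Rightarrow> bool" where
  "is_monic_OP n p \<longleftrightarrow> degree p = n \<and> lead_coeff p = 1 \<and>
     (\<forall>q. degree q < n \<longrightarrow> inner_L2 \<sigma> p q = 0)"

lemma is_monic_OP_unique:
  assumes "is_monic_OP n p" "is_monic_OP n q"
  shows "p = q"
proof (rule ccontr)
  assume "p \<noteq> q"
  then have "degree (p - q) < n"
    using assms by (intro degree_diff_monic_less) (auto simp: is_monic_OP_def)
  then have "inner_L2 \<sigma> (p - q) (p - q) = 0"
    using assms by (auto simp: is_monic_OP_def inner_diff_left)
  then have "norm_L2 \<sigma> (p - q) = 0"
    by (simp add: inner_self)
  then show False
    using norm_eq_0_imp \<open>p \<noteq> q\<close> by fastforce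
qed

lemma is_monic_OP_inner_monic:
  assumes "is_monic_OP n p" "degree q = n" "lead_coeff q = 1"
  shows "inner_L2 \<sigma> p q = complex_of_real ((norm_L2 \<sigma> p)\<^sup>2)"
\<comment> \<open>For \<open>q = p\<close> the difference has degree 0, which fails to be less than
  \<open>n\<close> if \<open>n = 0\<close>.\<close>
proof (cases "q = p")
  case False
  then have "degree (q - p) < n"
    using assms by (intro degree_diff_monic_less) (auto simp: is_monic_OP_def)
  then have "inner_L2 \<sigma> p (q - p) = 0"
    using assms by (auto simp: is_monic_OP_def)
  then show ?thesis
    by (simp add: inner_diff_right inner_self)
qed (simp add: inner_self)

section \<open>Reversal, the Szego recursion and existence\<close>

lemma inner_cnj_reflect_poly:
  assumes "j \<le> degree p"
  shows "inner_L2 \<sigma> (cnj_reflect_poly p) (monom 1 j) = inner_L2 \<sigma> (monom 1 (degree p - j)) p"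
  unfolding inner_L2_def
proof (rule Bochner_Integration.integral_cong[OF refl])
  fix z assume z: "z \<in> space \<sigma>"
  have "z ^ degree p * cnj (z ^ j) = z ^ (degree p - j) * (z ^ j * cnj (z ^ j))"
    using assms by (simp add: mult.assoc flip: power_add)
  also have "\<dots> = z ^ (degree p - j)"
    using power_mult_cnj[OF cmod_space[OF z], of j] by simp
  finally have "z ^ degree p * cnj (z ^ j) = z ^ (degree p - j)" .
  then show "poly (cnj_reflect_poly p) z * cnj (poly (monom 1 j) z)
      = poly (monom 1 (degree p - j)) z * cnj (poly p z)"
    by (simp add: poly_cnj_reflect_poly_circle[OF cmod_space[OF z]] poly_monom mult_ac
        flip: mult.assoc[of "z ^ degree p"])
qed

lemma norm_cnj_reflect_poly: "norm_L2 \<sigma> (cnj_reflect_poly p) = norm_L2 \<sigma> p"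
  unfolding norm_L2_def
  by (intro arg_cong[where f = sqrt] Bochner_Integration.integral_cong[OF refl])
    (simp add: poly_cnj_reflect_poly_circle cmod_space norm_mult norm_power)

lemma inner_sum_left: "inner_L2 \<sigma> (\<Sum>i\<in>A. f i) q = (\<Sum>i\<in>A. inner_L2 \<sigma> (f i) q)"
  by (induction A rule: infinite_finite_induct) (simp_all add: inner_add_left, simp_all add: inner_L2_def)

lemma inner_sum_right: "inner_L2 \<sigma> q (\<Sum>i\<in>A. f i) = (\<Sum>i\<in>A. inner_L2 \<sigma> q (f i))"
  by (subst inner_cnj[symmetric]) (simp add: inner_sum_left inner_cnj)

lemma inner_eq_0_if_monom:
  assumes "\<And>j. j < n \<Longrightarrow> inner_L2 \<sigma> p (monom 1 j) = 0" "degree q < n"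
  shows "inner_L2 \<sigma> p q = 0"
proof -
  have "inner_L2 \<sigma> p q = inner_L2 \<sigma> p (\<Sum>i\<le>degree q. smult (coeff q i) (monom 1 i))"
    by (simp add: smult_monom poly_as_sum_of_monoms)
  also have "\<dots> = (\<Sum>i\<le>degree q. cnj (coeff q i) * inner_L2 \<sigma> p (monom 1 i))"
    by (simp only: inner_sum_right inner_smult_right)
  also have "\<dots> = 0"
    using assms by (intro sum.neutral) auto
  finally show ?thesis .
qed

text \<open>Both \<open>z * p\<close> and the reversed polynomial are orthogonal to
  \<open>z, ..., z ^ n\<close>: the former by shifting, the latter because reversal turns these
  pairings into pairings of \<open>p\<close> with lower powers. One free coefficient then suffices
  to achieve orthogonality to 1.\<close>

lemma is_monic_OP_Suc:
  assumes p: "is_monic_OP n p"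
  shows "\<exists>g. is_monic_OP (Suc n) (monom 1 1 * p - smult (cnj g) (cnj_reflect_poly p))"
proof -
  have deg: "degree p = n" and lead: "lead_coeff p = 1" and nz: "p \<noteq> 0"
    using p by (auto simp: is_monic_OP_def)
  have degR: "degree (cnj_reflect_poly p) \<le> n"
    using degree_cnj_reflect_poly_le deg by auto
  have monom_p: "inner_L2 \<sigma> (monom 1 j) p = 0" if "j < n" for j
    using p that by (subst inner_cnj[symmetric]) (simp add: is_monic_OP_def degree_monom_eq)
  \<comment> \<open>Reversal turns the pairing with 1 into the pairing of \<open>p\<close> with the
    monic polynomial \<open>z ^ n\<close>. The value is nonzero, so \<open>g\<close> below can be
    obtained by division.\<close>
  have R0: "inner_L2 \<sigma> (cnj_reflect_poly p) (monom 1 0) = complex_of_real ((norm_L2 \<sigma> p)\<^sup>2)"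
    using is_monic_OP_inner_monic[OF p, of "monom 1 n"] inner_cnj[of p "monom 1 n"]
      inner_cnj_reflect_poly[of 0 p]
    by (simp add: deg degree_monom_eq del: monom_0)
  have norm_nz: "norm_L2 \<sigma> p \<noteq> 0"
    using nz norm_eq_0_imp by blast
  define g where "g = cnj (inner_L2 \<sigma> (monom 1 1 * p) (monom 1 0) / complex_of_real ((norm_L2 \<sigma> p)\<^sup>2))"
  define q where "q = monom 1 1 * p - smult (cnj g) (cnj_reflect_poly p)"
  have "inner_L2 \<sigma> q (monom 1 j) = 0" if "j < Suc n" for j
  proof (cases j)
    case 0
    then show ?thesis
      unfolding q_def using R0 norm_nz by (simp add: inner_diff_left inner_smult_left g_def)
  next
    case (Suc i)
    then have i: "i < n" using that by simp
    have "inner_L2 \<sigma> (monom 1 1 * p) (monom 1 j) = inner_L2 \<sigma> p (monom 1 i)"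
      using inner_monom_mult[of 1 p "monom 1 i"] Suc by (simp add: mult_monom)
    also have "\<dots> = 0"
      using p i by (simp add: is_monic_OP_def degree_monom_eq)
    finally show ?thesis
      unfolding q_def using Suc i
      by (simp add: inner_diff_left inner_smult_left inner_cnj_reflect_poly deg monom_p)
  qed
  then have orth: "inner_L2 \<sigma> q r = 0" if "degree r < Suc n" for r
    using inner_eq_0_if_monom that by blast
  have X: "monom 1 1 * p = pCons 0 p"
    by (simp add: monom_Suc)
  \<comment> \<open>The subtracted term has degree at most \<open>n\<close>, so \<open>q\<close>
    inherits its degree and leading coefficient from \<open>z * p\<close>.\<close>
  have "degree (smult (cnj g) (cnj_reflect_poly p)) < degree (monom 1 1 * p)"
    using degR deg nz unfolding X by (auto intro: le_less_trans[OF degree_smult_le])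
  then have deg_q: "degree q = degree (monom 1 1 * p)"
    unfolding q_def diff_conv_add_uminus by (intro degree_add_eq_left) (simp only: degree_minus)
  moreover have "lead_coeff q = lead_coeff (monom 1 1 * p)"
    unfolding deg_q using degR deg nz unfolding q_def X by (simp add: coeff_eq_0)
  ultimately have "is_monic_OP (Suc n) q"
    unfolding is_monic_OP_def X using deg lead nz orth by simp
  then show ?thesis
    unfolding q_def by blast
qed

lemma ex_is_monic_OP: "\<exists>p. is_monic_OP n p"
proof (induction n)
  case 0
  show ?case
    by (rule exI[of _ 1]) (simp add: is_monic_OP_def)
qed (use is_monic_OP_Suc in blast)

lemma is_monic_OP_monic_OP: "is_monic_OP n (monic_OP \<sigma> n)"
  using theI'[of "is_monic_OP n"] ex_is_monic_OP[of n] is_monic_OP_unique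
  unfolding monic_OP_def is_monic_OP_def[symmetric] by blast

lemma degree_monic_OP [simp]: "degree (monic_OP \<sigma> n) = n"
  and lead_coeff_monic_OP: "lead_coeff (monic_OP \<sigma> n) = 1"
  and inner_monic_OP: "degree q < n \<Longrightarrow> inner_L2 \<sigma> (monic_OP \<sigma> n) q = 0"
  using is_monic_OP_monic_OP[of n] by (auto simp: is_monic_OP_def)

lemma monic_OP_nonzero: "monic_OP \<sigma> n \<noteq> 0"
  using lead_coeff_monic_OP[of n] by auto

lemma norm_monic_OP_pos: "norm_L2 \<sigma> (monic_OP \<sigma> n) > 0"
  using norm_eq_0_imp[of "monic_OP \<sigma> n"] monic_OP_nonzero norm_nonneg[of "monic_OP \<sigma> n"]
  by fastforce

text \<open>Existence and uniqueness already give the recursion with some coefficient; what remains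
  is to identify it with the definite description \<open>verblunsky\<close>.\<close>

lemma szego_recursion:
  "monic_OP \<sigma> (Suc n) = monom 1 1 * monic_OP \<sigma> n
     - smult (cnj (verblunsky \<sigma> n)) (cnj_reflect_poly (monic_OP \<sigma> n))"
proof -
  let ?p = "monic_OP \<sigma> n" and ?R = "cnj_reflect_poly (monic_OP \<sigma> n)"
  obtain g where "is_monic_OP (Suc n) (monom 1 1 * ?p - smult (cnj g) ?R)"
    using is_monic_OP_Suc[OF is_monic_OP_monic_OP] by blast
  then have g: "monic_OP \<sigma> (Suc n) = monom 1 1 * ?p - smult (cnj g) ?R"
    using is_monic_OP_unique is_monic_OP_monic_OP by blast
  have rev: "reversed_OP \<sigma> n z = poly ?R z" if "z \<noteq> 0" for z
    using that by (simp add: reversed_OP_def poly_cnj_reflect_poly)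
  \<comment> \<open>The coefficient is determined by evaluating at one nonzero point that is not a
    root of the reversed polynomial.\<close>
  have "?R \<noteq> 0"
    using norm_cnj_reflect_poly[of ?p] norm_monic_OP_pos[of n] by (auto simp: norm_L2_def)
  then have "finite (insert 0 {z. poly ?R z = 0})"
    by (simp add: poly_roots_finite)
  then obtain w where w: "w \<noteq> 0" "poly ?R w \<noteq> 0"
    using ex_new_if_finite[OF infinite_UNIV_char_0] by blast
  have "verblunsky \<sigma> n = g"
    unfolding verblunsky_def
  proof (rule the_equality)
    fix g' assume "\<forall>z. z \<noteq> 0 \<longrightarrow> poly (monic_OP \<sigma> (Suc n)) z
      = z * poly ?p z - cnj g' * reversed_OP \<sigma> n z"
    then show "g' = g"
      using w rev[of w] g by (auto simp: poly_monom)
  qed (auto simp: g rev poly_monom)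
  with g show ?thesis by simp
qed

text \<open>Pythagoras: \<open>z * \<Phi>\<^sub>n\<close> is the sum of
  \<open>\<Phi>\<^sub>n\<^sub>+\<^sub>1\<close> and a multiple of the reversed polynomial, which has
  degree at most \<open>n\<close> and so is orthogonal to it. Multiplication by \<open>z\<close> and
  reversal preserve the norm.\<close>

lemma norm_sq_monic_OP_Suc:
  "(norm_L2 \<sigma> (monic_OP \<sigma> (Suc n)))\<^sup>2
     = (1 - (cmod (verblunsky \<sigma> n))\<^sup>2) * (norm_L2 \<sigma> (monic_OP \<sigma> n))\<^sup>2"
proof -
  let ?p = "monic_OP \<sigma> n" and ?R = "cnj_reflect_poly (monic_OP \<sigma> n)"
  let ?g = "cnj (verblunsky \<sigma> n)"
  have "degree ?R < Suc n"
    using degree_cnj_reflect_poly_le[of ?p] by simp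
  then have "inner_L2 \<sigma> (monic_OP \<sigma> (Suc n)) (smult ?g ?R) = 0"
    by (simp add: inner_smult_right inner_monic_OP)
  moreover have "monom 1 1 * ?p = monic_OP \<sigma> (Suc n) + smult ?g ?R"
    by (simp add: szego_recursion)
  ultimately have "(norm_L2 \<sigma> ?p)\<^sup>2 = (norm_L2 \<sigma> (monic_OP \<sigma> (Suc n)))\<^sup>2
      + (norm_L2 \<sigma> (smult ?g ?R))\<^sup>2"
    using norm_add_sq[of "monic_OP \<sigma> (Suc n)" "smult ?g ?R"] norm_monom_mult[of 1 ?p] by simp
  then show ?thesis
    by (simp add: norm_smult norm_cnj_reflect_poly power_mult_distrib algebra_simps)
qed

text \<open>The product of the \<open>1 - |\<gamma>\<^sub>s|\<^sup>2\<close> is at least 1 minus the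
  sum of the \<open>|\<gamma>\<^sub>s|\<^sup>2\<close>. Both bounds share one induction: the upper
  one limits the loss per step in the lower one to \<open>?v * ?h m\<close>.\<close>

lemma norm_sq_monic_OP_ge:
  "(norm_L2 \<sigma> (monic_OP \<sigma> (m + k)))\<^sup>2
     \<ge> (1 - (\<Sum>i<k. (cmod (verblunsky \<sigma> (m + i)))\<^sup>2)) * (norm_L2 \<sigma> (monic_OP \<sigma> m))\<^sup>2"
  and norm_sq_monic_OP_le:
  "(norm_L2 \<sigma> (monic_OP \<sigma> (m + k)))\<^sup>2 \<le> (norm_L2 \<sigma> (monic_OP \<sigma> m))\<^sup>2"
proof (induction k)
  case (Suc k)
  let ?h = "\<lambda>n. (norm_L2 \<sigma> (monic_OP \<sigma> n))\<^sup>2" and ?v = "(cmod (verblunsky \<sigma> (m + k)))\<^sup>2"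
  have eq: "?h (m + Suc k) = ?h (m + k) - ?v * ?h (m + k)"
    using norm_sq_monic_OP_Suc[of "m + k"] by (simp add: left_diff_distrib)
  {
    case 1
    have "?v * ?h (m + k) \<le> ?v * ?h m"
      using Suc(2) by (intro mult_left_mono) auto
    then show ?case
      using Suc(1) eq by (simp add: algebra_simps)
  next
    case 2
    have "?v * ?h (m + k) \<ge> 0" by simp
    then show ?case
      using Suc(2) eq by linarith
  }
qed simp_all

section \<open>Comparing shifted orthonormal polynomials with later ones\<close>

lemma inner_orthonormal_OP_monom_mult:
  "inner_L2 \<sigma> (orthonormal_OP \<sigma> (m + k)) (monom 1 k * orthonormal_OP \<sigma> m)
     = complex_of_real (norm_L2 \<sigma> (monic_OP \<sigma> (m + k)) / norm_L2 \<sigma> (monic_OP \<sigma> m))"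
proof -
  have "degree (monom 1 k * monic_OP \<sigma> m) = m + k"
    using monic_OP_nonzero[of m] by (simp add: degree_mult_eq degree_monom_eq monom_eq_0_iff)
  moreover have "lead_coeff (monom 1 k * monic_OP \<sigma> m) = 1"
    by (simp only: lead_coeff_mult lead_coeff_monic_OP lead_coeff_monom mult_1)
  ultimately have "inner_L2 \<sigma> (monic_OP \<sigma> (m + k)) (monom 1 k * monic_OP \<sigma> m)
      = complex_of_real ((norm_L2 \<sigma> (monic_OP \<sigma> (m + k)))\<^sup>2)"
    by (rule is_monic_OP_inner_monic[OF is_monic_OP_monic_OP])
  then show ?thesis
    using norm_monic_OP_pos[of "m + k"]
    by (simp add: orthonormal_OP_def inner_smult_left inner_smult_right power2_eq_square)
qed

lemma norm_orthonormal_OP [simp]: "norm_L2 \<sigma> (orthonormal_OP \<sigma> n) = 1"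
  using norm_monic_OP_pos[of n] by (simp add: orthonormal_OP_def norm_smult norm_divide)

lemma degree_orthonormal_OP [simp]: "degree (orthonormal_OP \<sigma> n) = n"
  using norm_monic_OP_pos[of n] by (simp add: orthonormal_OP_def)

lemma inner_orthonormal_OP: "degree q < n \<Longrightarrow> inner_L2 \<sigma> (orthonormal_OP \<sigma> n) q = 0"
  by (simp add: orthonormal_OP_def inner_smult_left inner_monic_OP)

lemma norm_sq_shift_diff_le:
  "(norm_L2 \<sigma> (orthonormal_OP \<sigma> (m + k) - monom 1 k * orthonormal_OP \<sigma> m))\<^sup>2
     \<le> 2 * (\<Sum>i<k. (cmod (verblunsky \<sigma> (m + i)))\<^sup>2)"
proof -
  define x where "x = norm_L2 \<sigma> (monic_OP \<sigma> (m + k)) / norm_L2 \<sigma> (monic_OP \<sigma> m)"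
  have pos: "norm_L2 \<sigma> (monic_OP \<sigma> m) > 0"
    by (rule norm_monic_OP_pos)
  have x: "0 \<le> x" "x \<le> 1" "x\<^sup>2 \<ge> 1 - (\<Sum>i<k. (cmod (verblunsky \<sigma> (m + i)))\<^sup>2)"
    using pos norm_sq_monic_OP_ge[of m k] norm_nonneg
      power2_le_imp_le[OF norm_sq_monic_OP_le norm_nonneg, of m k]
    by (simp_all add: x_def power_divide pos_le_divide_eq)
  \<comment> \<open>The squared distance is \<open>2 - 2 * x\<close>, so this bounds it by
    \<open>2 - 2 * x\<^sup>2\<close>.\<close>
  then have "x\<^sup>2 \<le> x"
    by (simp add: power2_eq_square mult_left_le)
  then show ?thesis
    using x by (simp add: norm_diff_sq inner_orthonormal_OP_monom_mult norm_monom_mult flip: x_def)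
qed

text \<open>Pythagoras again. In the inner product \<open>?B\<close> stands first, since
  \<open>inner_orthonormal_OP\<close> wants the higher degree on the left.\<close>

lemma norm_sq_sum_orthonormal_OP:
  assumes "cmod w = 1"
  shows "(norm_L2 \<sigma> (\<Sum>k<N. smult (w ^ k) (orthonormal_OP \<sigma> (m + k))))\<^sup>2 = real N"
proof (induction N)
  case 0
  show ?case by (simp add: norm_L2_def)
next
  case (Suc N)
  let ?A = "\<Sum>k<N. smult (w ^ k) (orthonormal_OP \<sigma> (m + k))"
  let ?B = "smult (w ^ N) (orthonormal_OP \<sigma> (m + N))"
  have "inner_L2 \<sigma> ?B ?A = 0"
    unfolding inner_sum_right inner_smult_right inner_smult_left
    by (intro sum.neutral) (auto simp: inner_orthonormal_OP)
  then show ?case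
    using norm_add_sq[of ?B ?A] Suc assms by (simp add: norm_smult norm_power add.commute)
qed

section \<open>Integrals over sets where the geometric sum is large\<close>

lemma set_integral_orthonormal_OP_le:
  assumes N: "N > 0" and w: "cmod w = 1"
    and I: "\<And>z. z \<in> I \<Longrightarrow> cmod z = 1 \<Longrightarrow> cmod (\<Sum>k<N. (w * z) ^ k) \<ge> real N / 2"
  shows "(LINT z:I|\<sigma>. (cmod (poly (orthonormal_OP \<sigma> m) z))\<^sup>2)
    \<le> 8 / real N + 16 * (\<Sum>i<N. (cmod (verblunsky \<sigma> (m + i)))\<^sup>2)"
proof -
  define V where "V = (\<Sum>i<N. (cmod (verblunsky \<sigma> (m + i)))\<^sup>2)"
  define A where "A = (\<Sum>k<N. smult (w ^ k) (orthonormal_OP \<sigma> (m + k)))"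
  define D where "D k = orthonormal_OP \<sigma> (m + k) - monom 1 k * orthonormal_OP \<sigma> m" for k
  \<comment> \<open>On \<open>I\<close>, with \<open>f\<close> and \<open>d\<close> as below,
    \<open>N / 2 * |f| \<le> |A| + |d|\<close>. Squaring gives the factor
    \<open>4 / N\<^sup>2\<close>, splitting the square of the sum gives the factors 2, and
    Cauchy-Schwarz for the \<open>N\<close> terms of \<open>d\<close> gives the factor
    \<open>N\<close>.\<close>
  define F where "F z = 4 / (real N)\<^sup>2 *
    (2 * (cmod (poly A z))\<^sup>2 + 2 * real N * (\<Sum>k<N. (cmod (poly (D k) z))\<^sup>2))" for z
  have F_nonneg: "F z \<ge> 0" for z
    by (simp add: F_def sum_nonneg)
  have intF: "integrable \<sigma> F"
    unfolding F_def by (intro integrable_continuous continuous_intros)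
  have pointwise: "indicator I z *\<^sub>R (cmod (poly (orthonormal_OP \<sigma> m) z))\<^sup>2 \<le> F z"
    if "z \<in> space \<sigma>" for z
  proof (cases "z \<in> I")
    case True
    let ?f = "poly (orthonormal_OP \<sigma> m) z"
    define d where "d = (\<Sum>k<N. w ^ k * poly (D k) z)"
    \<comment> \<open>Termwise, \<open>z ^ k * \<phi>\<^sub>m\<close> is
      \<open>\<phi>\<^sub>m\<^sub>+\<^sub>k\<close> minus \<open>D k\<close>.\<close>
    have "(\<Sum>k<N. (w * z) ^ k) * ?f = poly A z - d"
      by (simp add: A_def d_def D_def poly_sum poly_monom sum_distrib_right power_mult_distrib
          right_diff_distrib sum_subtractf mult.assoc)
    then have "cmod (\<Sum>k<N. (w * z) ^ k) * cmod ?f \<le> cmod (poly A z) + cmod d"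
      by (metis norm_mult norm_triangle_ineq4)
    moreover have "real N / 2 * cmod ?f \<le> cmod (\<Sum>k<N. (w * z) ^ k) * cmod ?f"
      using I[OF True cmod_space[OF that]] by (intro mult_right_mono) auto
    ultimately have "(real N / 2 * cmod ?f)\<^sup>2 \<le> (cmod (poly A z) + cmod d)\<^sup>2"
      by (intro power_mono) auto
    also have "\<dots> \<le> 2 * (cmod (poly A z))\<^sup>2 + 2 * (cmod d)\<^sup>2"
      using zero_le_power2[of "cmod (poly A z) - cmod d"]
      by (simp add: power2_eq_square algebra_simps)
    also have "(cmod d)\<^sup>2 \<le> (\<Sum>k<N. cmod (poly (D k) z))\<^sup>2"
      unfolding d_def using w
      by (intro power_mono order_trans[OF norm_sum]) (auto simp: norm_mult norm_power)
    also have "\<dots> \<le> real N * (\<Sum>k<N. (cmod (poly (D k) z))\<^sup>2)"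
      using sum_squared_le_sum_of_squares[of "\<lambda>k. cmod (poly (D k) z)" "{..<N}"]
      by (simp add: mult.commute)
    finally show ?thesis
      using True N by (simp add: F_def power_mult_distrib power_divide field_simps)
  qed (simp add: F_nonneg)
  have "(LINT z:I|\<sigma>. (cmod (poly (orthonormal_OP \<sigma> m) z))\<^sup>2) \<le> (LINT z|\<sigma>. F z)"
    unfolding set_lebesgue_integral_def
    \<comment> \<open>Only the majorant must be integrable: a nonintegrable function has integral 0
      by default, and \<open>F\<close> is nonnegative. So no measurability of \<open>I\<close> has
      to be shown.\<close>
    by (rule integral_mono'[OF intF pointwise F_nonneg])
  also have "\<dots> = 4 / (real N)\<^sup>2 *
      (2 * (norm_L2 \<sigma> A)\<^sup>2 + 2 * real N * (\<Sum>k<N. (norm_L2 \<sigma> (D k))\<^sup>2))"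
    unfolding F_def norm_sq by (simp add: integrable_cmod_sq)
  also have "\<dots> \<le> 4 / (real N)\<^sup>2 * (2 * real N + 2 * real N * (\<Sum>k<N. 2 * V))"
  proof (intro mult_left_mono add_mono sum_mono)
    fix k assume "k \<in> {..<N}"
    then have "(\<Sum>i<k. (cmod (verblunsky \<sigma> (m + i)))\<^sup>2) \<le> V"
      unfolding V_def by (intro sum_mono2) auto
    then show "(norm_L2 \<sigma> (D k))\<^sup>2 \<le> 2 * V"
      using norm_sq_shift_diff_le[of m k] by (simp add: D_def)
  qed (auto simp: A_def norm_sq_sum_orthonormal_OP[OF w])
  also have "\<dots> = 8 / real N + 16 * V"
    using N by (simp add: field_simps power2_eq_square)
  finally show ?thesis
    by (simp add: V_def)
qed

text \<open>This serves for arcs longer than 1.\<close>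

lemma set_integral_orthonormal_OP_le_1:
  "(LINT z:I|\<sigma>. (cmod (poly (orthonormal_OP \<sigma> m) z))\<^sup>2) \<le> 1"
proof -
  have "(LINT z:I|\<sigma>. (cmod (poly (orthonormal_OP \<sigma> m) z))\<^sup>2)
      \<le> (LINT z|\<sigma>. (cmod (poly (orthonormal_OP \<sigma> m) z))\<^sup>2)"
    unfolding set_lebesgue_integral_def
    by (rule integral_mono'[OF integrable_cmod_sq]) (auto simp: indicator_def)
  then show ?thesis
    by (simp flip: norm_sq)
qed

end

section \<open>Angles within an arc and the geometric sum\<close>

lemma is_interval_diff_le_arclength:
  assumes J: "is_interval J" "x \<in> J" "y \<in> J" "x \<le> y"
    and pos: "0 < arclength (cis ` J)" and le: "arclength (cis ` J) \<le> 1"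
  shows "y - x \<le> arclength (cis ` J)"
proof -
  define S where "S = {t \<in> {0..<2 * pi}. cis t \<in> cis ` J}"
  \<comment> \<open>Full turns move \<open>x\<close> to \<open>a\<close> in
    \<open>[0, 2 * pi)\<close>, the range in which \<open>arclength\<close> measures angles. The
    other end \<open>b\<close> is cut off one turn after \<open>a\<close>, so that no point of the
    circle is counted twice.\<close>
  define k where "k = \<lfloor>x / (2 * pi)\<rfloor>"
  define a where "a = x - 2 * pi * of_int k"
  define b where "b = min y (x + 2 * pi) - 2 * pi * of_int k"
  have "of_int k \<le> x / (2 * pi)" "x / (2 * pi) < of_int k + 1"
    by (auto simp: k_def)
  then have a: "0 \<le> a" "a < 2 * pi"
    by (auto simp: a_def field_simps)
  have b: "a \<le> b" "b \<le> a + 2 * pi"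
    using J(4) by (auto simp: a_def b_def)
  have inJ: "cis s \<in> cis ` J" if "a \<le> s" "s \<le> b" for s
  proof -
    have "s + 2 * pi * of_int k \<in> J"
      by (rule mem_is_interval_1_I[OF J(1-3)]) (use that in \<open>auto simp: a_def b_def\<close>)
    moreover have "cis (s + 2 * pi * of_int k) = cis s"
      by (simp add: cis_multiple_2pi flip: cis_mult)
    ultimately show ?thesis by (metis imageI)
  qed
  \<comment> \<open>A nonmeasurable set has \<open>measure\<close> 0 by default, so positive
    arclength yields measurability.\<close>
  have "S \<in> sets lborel"
    using pos by (metis S_def arclength_def less_irrefl measure_notin_sets)
  moreover have "emeasure lborel S \<le> emeasure lborel {0..<2 * pi}"
    by (intro emeasure_mono) (auto simp: S_def)
  ultimately have S: "S \<in> fmeasurable lborel"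
    by (intro fmeasurableI) (auto intro: le_less_trans)
  \<comment> \<open>What sticks out beyond \<open>2 * pi\<close> is wrapped around to start at 0.
    The two pieces are disjoint because \<open>b \<le> a + 2 * pi\<close>.\<close>
  have sub: "{a..<min b (2 * pi)} \<union> {0..<b - 2 * pi} \<subseteq> S"
  proof -
    have "cis s \<in> cis ` J" if "0 \<le> s" "s < b - 2 * pi" for s
      using inJ[of "s + 2 * pi"] that a by (simp flip: cis_mult)
    then show ?thesis
      using inJ a b by (auto simp: S_def)
  qed
  have "measure lborel ({a..<min b (2 * pi)} \<union> {0..<b - 2 * pi})
      = measure lborel {a..<min b (2 * pi)} + measure lborel {0..<b - 2 * pi}"
    using b emeasure_bounded_finite[of "{a..<min b (2 * pi)}"]
      emeasure_bounded_finite[of "{0..<b - 2 * pi}"]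
    by (intro measure_Union) auto
  also have "\<dots> = b - a"
    using a b by (auto simp: min_def)
  finally have "b - a \<le> arclength (cis ` J)"
    using measure_mono_fmeasurable[OF sub _ S] by (simp add: arclength_def S_def)
  \<comment> \<open>Arclength at most 1 rules out a full turn, so the minimum is
    \<open>y - x\<close>.\<close>
  moreover have "b - a = min (y - x) (2 * pi)"
    by (auto simp: a_def b_def)
  ultimately show ?thesis
    using le pi_gt3 by linarith
qed

text \<open>All angles \<open>k * t\<close> are at most \<open>1 < pi / 3\<close> in absolute value,
  so every term has real part at least 1/2 and no cancellation occurs.\<close>

lemma norm_sum_cis_ge:
  assumes "real N * \<bar>t\<bar> \<le> 1"
  shows "cmod (\<Sum>k<N. cis t ^ k) \<ge> real N / 2"
proof -
  have "1 / 2 \<le> cos (real k * t)" if "k < N" for k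
  proof -
    have "\<bar>real k * t\<bar> \<le> real N * \<bar>t\<bar>"
      using that by (simp add: abs_mult mult_right_mono)
    then have "\<bar>real k * t\<bar> \<le> pi / 3"
      using assms pi_gt3 by linarith
    then have "cos (pi / 3) \<le> cos \<bar>real k * t\<bar>"
      by (intro cos_monotone_0_pi_le) auto
    then show ?thesis
      by (simp add: cos_60)
  qed
  then have "(\<Sum>k<N. 1 / 2) \<le> (\<Sum>k<N. cos (real k * t))"
    by (intro sum_mono) auto
  also have "\<dots> = Re (\<Sum>k<N. cis t ^ k)"
    by (simp only: Complex.DeMoivre Re_sum cis.sel)
  also have "\<dots> \<le> cmod (\<Sum>k<N. cis t ^ k)"
    by (rule complex_Re_le_cmod)
  finally show ?thesis by simp
qed

section \<open>The estimate for arcs and the theorem\<close>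

lemma set_integral_orthonormal_OP_arc_le:
  assumes "circle_measure \<sigma>" "is_arc I" "arclength I > 0"
  shows "(LINT z:I|\<sigma>. (cmod (poly (orthonormal_OP \<sigma> m) z))\<^sup>2)
    \<le> 16 * arclength I
      + 16 * (\<Sum>s\<in>{s. \<bar>real s - real m\<bar> < 1 / arclength I}. (cmod (verblunsky \<sigma> s))\<^sup>2)"
proof -
  interpret circle_measure \<sigma> by fact
  define L where "L = arclength I"
  define W where "W = {s. \<bar>real s - real m\<bar> < 1 / L}"
  have L: "L > 0" using assms(3) by (simp add: L_def)
  \<comment> \<open>Finiteness matters: a sum over an infinite set is 0 by default.\<close>
  have "W \<subseteq> {..nat \<lceil>real m + 1 / L\<rceil>}"
    unfolding W_def by (auto simp: le_nat_iff) linarith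
  then have finW: "finite W"
    using finite_subset by blast
  have "(LINT z:I|\<sigma>. (cmod (poly (orthonormal_OP \<sigma> m) z))\<^sup>2)
    \<le> 16 * L + 16 * (\<Sum>s\<in>W. (cmod (verblunsky \<sigma> s))\<^sup>2)"
  \<comment> \<open>For \<open>L > 1\<close> the integral is at most 1, hence below
    \<open>16 * L\<close>.\<close>
  proof (cases "L \<le> 1")
    case False
    moreover have "(\<Sum>s\<in>W. (cmod (verblunsky \<sigma> s))\<^sup>2) \<ge> 0"
      by (simp add: sum_nonneg)
    ultimately show ?thesis
      using set_integral_orthonormal_OP_le_1[of I m] by linarith
  next
    case True
    obtain J where J: "is_interval J" "I = cis ` J"
      using assms(2) by (auto simp: is_arc_def)
    \<comment> \<open>The empty set is an interval as well; positive arclength excludes it.\<close>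
    have "J \<noteq> {}"
      using assms(3) J by (auto simp: arclength_def)
    then obtain x where x: "x \<in> J" by blast
    \<comment> \<open>Rounding down gives \<open>N * |y - x| \<le> 1\<close> on the arc and keeps
      the indices \<open>m + i\<close> with \<open>i < N\<close> strictly inside the window
      \<open>W\<close>. Since \<open>N \<ge> 1\<close>, rounding costs at most a factor 2, whence
      \<open>8 / N \<le> 16 * L\<close>.\<close>
    define N where "N = nat \<lfloor>1 / L\<rfloor>"
    have "1 / L \<ge> 1" using L True by simp
    then have N: "N > 0" "real N \<le> 1 / L" "1 / L < real N + 1"
      unfolding N_def by linarith+
    have "cmod (\<Sum>k<N. (cis (- x) * z) ^ k) \<ge> real N / 2" if "z \<in> I" for z
    proof -
      obtain y where y: "y \<in> J" "z = cis y"
        using \<open>z \<in> I\<close> J(2) by blast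
      have "\<bar>y - x\<bar> \<le> L"
        using is_interval_diff_le_arclength[OF J(1) x y(1)]
          is_interval_diff_le_arclength[OF J(1) y(1) x] assms(3) True
        unfolding L_def J(2) by linarith
      then have "real N * \<bar>y - x\<bar> \<le> 1 / L * L"
        using N L by (intro mult_mono) auto
      then have "cmod (\<Sum>k<N. cis (y - x) ^ k) \<ge> real N / 2"
        using L by (intro norm_sum_cis_ge) simp
      then show ?thesis
        by (simp add: y(2) cis_mult add.commute)
    qed
    then have "(LINT z:I|\<sigma>. (cmod (poly (orthonormal_OP \<sigma> m) z))\<^sup>2)
        \<le> 8 / real N + 16 * (\<Sum>i<N. (cmod (verblunsky \<sigma> (m + i)))\<^sup>2)"
      using N by (intro set_integral_orthonormal_OP_le[where w = "cis (- x)"]) auto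
    moreover have "8 / real N \<le> 16 * L"
    proof -
      have "1 / L \<le> 2 * real N" using N by linarith
      then show ?thesis using L N by (simp add: field_simps)
    qed
    moreover have "(\<Sum>i<N. (cmod (verblunsky \<sigma> (m + i)))\<^sup>2) \<le> (\<Sum>s\<in>W. (cmod (verblunsky \<sigma> s))\<^sup>2)"
    proof -
      have "(\<Sum>i<N. (cmod (verblunsky \<sigma> (m + i)))\<^sup>2)
          = (\<Sum>s\<in>(\<lambda>i. m + i) ` {..<N}. (cmod (verblunsky \<sigma> s))\<^sup>2)"
        by (simp add: sum.reindex)
      also have "\<dots> \<le> (\<Sum>s\<in>W. (cmod (verblunsky \<sigma> s))\<^sup>2)"
        using N finW by (intro sum_mono2) (auto simp: W_def)
      finally show ?thesis .
    qed
    ultimately show ?thesis by linarith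
  qed
  then show ?thesis
    by (simp add: L_def W_def)
qed

text \<open>The summand \<open>n = 0\<close> has weight 1 whatever \<open>l\<close> is, which makes
  the final constant independent of \<open>l\<close>.\<close>

lemma verblunsky_tail_ge_first_term:
  "ennreal (\<Sum>s\<in>{s. \<bar>real s - real m\<bar> < \<nu>}. (cmod (verblunsky \<sigma> s))\<^sup>2) \<le> verblunsky_tail \<sigma> \<nu> m l"
  unfolding verblunsky_tail_def
  by (rule order_trans[OF _ sum_le_suminf[of _ "{0}"]]) auto

theorem lemma4p1:
  "\<forall>c::real. c > 0 \<longrightarrow>
    (\<exists>C::real. C > 0 \<and> (\<forall>l::nat. \<exists>Cl::real. Cl > 0 \<and>
      (\<forall>(\<sigma>::complex measure) (I::complex set) (m::nat).
         circle_prob_measure \<sigma> \<longrightarrow> even_measure \<sigma> \<longrightarrow> infinite (circle_support \<sigma>) \<longrightarrow>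
         ell2_norm_le (verblunsky \<sigma>) (1 / 2) \<longrightarrow>
         is_arc I \<longrightarrow> arclength I > 0 \<longrightarrow>
         (let \<nu> = 1 / arclength I in
           real m \<ge> c * \<nu> \<longrightarrow>
           ennreal (LINT z:I|\<sigma>. (cmod (poly (orthonormal_OP \<sigma> m) z))\<^sup>2)
             \<le> ennreal (C * arclength I)
               + ennreal Cl * verblunsky_tail \<sigma> \<nu> m l
               + ennreal (Cl * (real m / \<nu>) powi (- int l))))))"
\<comment> \<open>The value 16, the constant of the arc estimate, is the witness for both
  \<open>C\<close> and \<open>Cl\<close>.\<close>
proof (intro allI impI exI[of _ 16] conjI)
  fix c :: real and l :: nat and \<sigma> :: "complex measure" and I :: "complex set" and m :: nat
  assume "circle_prob_measure \<sigma>" "infinite (circle_support \<sigma>)"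
    and I: "is_arc I" "arclength I > 0"
  then have \<sigma>: "circle_measure \<sigma>"
    by unfold_locales
  define \<nu> where "\<nu> = 1 / arclength I"
  let ?S = "\<Sum>s\<in>{s. \<bar>real s - real m\<bar> < \<nu>}. (cmod (verblunsky \<sigma> s))\<^sup>2"
  have "ennreal (LINT z:I|\<sigma>. (cmod (poly (orthonormal_OP \<sigma> m) z))\<^sup>2)
      \<le> ennreal (16 * arclength I + 16 * ?S)"
    unfolding \<nu>_def by (intro ennreal_leI set_integral_orthonormal_OP_arc_le \<sigma> I)
  also have "\<dots> = ennreal (16 * arclength I) + ennreal 16 * ennreal ?S"
    using I(2) by (simp only: ennreal_plus[symmetric] ennreal_mult[symmetric] sum_nonneg
        zero_le_power2 mult_nonneg_nonneg zero_le_numeral less_imp_le)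
  also have "\<dots> \<le> ennreal (16 * arclength I) + ennreal 16 * verblunsky_tail \<sigma> \<nu> m l"
    by (intro add_left_mono mult_left_mono verblunsky_tail_ge_first_term) auto
  also have "\<dots> \<le> \<dots> + ennreal (16 * (real m / \<nu>) powi (- int l))"
    by simp
  finally show "let \<nu> = 1 / arclength I in real m \<ge> c * \<nu> \<longrightarrow>
      ennreal (LINT z:I|\<sigma>. (cmod (poly (orthonormal_OP \<sigma> m) z))\<^sup>2)
        \<le> ennreal (16 * arclength I) + ennreal 16 * verblunsky_tail \<sigma> \<nu> m l
          + ennreal (16 * (real m / \<nu>) powi (- int l))"
    by (simp add: \<nu>_def Let_def)
qed simp_all

end
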